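(* Let $L$ be a finite lattice, let $\varphi$ be a capacity on $L$ and $\psi$ a completely monotone capacity on $L$. Suppose that $$\Lambda_{a_1,\ldots,a_k}\varphi(\hat1)\le\nabla_{a_1,\ldots,a_k}\psi(\hat1)\quad\text{for every monotone path }(a_1,\dots,a_k)\text{ in }L.$$ Then there exist an $\mathcal L$-valued random variable $\mathcal X$ and an $L$-valued random variable $Y$ on a common probability space with $\mathbb P(x\in\mathcal X)=\varphi(x)$ and $\mathbb P(Y\le x)=\psi(x)$ for all $x\in L$, and $\mathbb P(Y\in\mathcal X)=1$.
   Context: $L$ is a finite lattice with minimum $\hat0$, maximum $\hat1$, meet $\wedge$, join $\vee$. A capacity is a monotone $\varphi$ with $\varphi(\hat0)=0$, $\varphi(\hat1)=1$. $\nabla_a\varphi(x)=\varphi(x)-\varphi(x\wedge a)$, $\nabla_{a_1,\ldots,a_k}\varphi=\nabla_{a_k}(\nabla_{a_1,\ldots,a_{k-1}}\varphi)$; completely monotone means all these are nonnegative. $\mathcal L$ is the set of nonempty up-sets of $L$. A path from $a$ to $b$ is a sequence $H=(h_0,\dots,h_m)$ of distinct elements of $L$ with $h_0=a$, $h_m=b$; $\varphi(H)=\sum_{i=0}^m\varphi(h_i)-\sum_{i=1}^m\varphi(h_{i-1}\vee h_i)$; $\lambda(\varphi;a,b)=\max\{\varphi(H): H\text{ a path from }a\text{ to }b\}$; $\Lambda_a\varphi(x)=\varphi(x)-\lambda(\varphi;a,x)$ and $\Lambda_{a_1,\ldots,a_k}\varphi=\Lambda_{a_k}(\Lambda_{a_1,\ldots,a_{k-1}}\varphi)$.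 A monotone path is a sequence $(a_1,\dots,a_k)$, $k\ge1$, of distinct elements of $L$ such that $i<j$ whenever $a_i<a_j$. *)

theory Defs
  imports "HOL-Probability.Probability"
begin

definition capacity :: "('a::{finite,bounded_lattice} \<Rightarrow> real) \<Rightarrow> bool" where
  "capacity \<phi> \<longleftrightarrow> mono \<phi> \<and> \<phi> bot = 0 \<and> \<phi> top = 1"

definition nabla :: "'a::{finite,bounded_lattice} \<Rightarrow> ('a \<Rightarrow> real) \<Rightarrow> 'a \<Rightarrow> real" where
  "nabla a \<phi> x = \<phi> x - \<phi> (inf x a)"

definition nabla_list :: "'a::{finite,bounded_lattice} list \<Rightarrow> ('a \<Rightarrow> real) \<Rightarrow> 'a \<Rightarrow> real" where
  "nabla_list as \<phi> = fold nabla as \<phi>"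

definition completely_monotone :: "('a::{finite,bounded_lattice} \<Rightarrow> real) \<Rightarrow> bool" where
  "completely_monotone \<phi> \<longleftrightarrow> (\<forall>as x. as \<noteq> [] \<longrightarrow> nabla_list as \<phi> x \<ge> 0)"

definition upsets :: "'a::{finite,bounded_lattice} set set" where
  "upsets = {U. U \<noteq> {} \<and> (\<forall>x y. x \<in> U \<and> x \<le> y \<longrightarrow> y \<in> U)}"

definition is_path :: "'a list \<Rightarrow> 'a \<Rightarrow> 'a \<Rightarrow> bool" where
  "is_path H a b \<longleftrightarrow> H \<noteq> [] \<and> distinct H \<and> hd H = a \<and> last H = b"

definition path_val :: "('a::{finite,bounded_lattice} \<Rightarrow> real) \<Rightarrow> 'a list \<Rightarrow> real" where
  "path_val \<phi> H = (\<Sum>h\<leftarrow>H. \<phi> h) - (\<Sum>(g,h)\<leftarrow>zip H (tl H). \<phi> (sup g h))"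

definition lam :: "('a::{finite,bounded_lattice} \<Rightarrow> real) \<Rightarrow> 'a \<Rightarrow> 'a \<Rightarrow> real" where
  "lam \<phi> a b = Max {path_val \<phi> H | H. is_path H a b}"

definition Lambda :: "'a::{finite,bounded_lattice} \<Rightarrow> ('a \<Rightarrow> real) \<Rightarrow> 'a \<Rightarrow> real" where
  "Lambda a \<phi> x = \<phi> x - lam \<phi> a x"

definition Lambda_list :: "'a::{finite,bounded_lattice} list \<Rightarrow> ('a \<Rightarrow> real) \<Rightarrow> 'a \<Rightarrow> real" where
  "Lambda_list as \<phi> = fold Lambda as \<phi>"

definition monotone_path :: "'a::{finite,bounded_lattice} list \<Rightarrow> bool" where
  "monotone_path as \<longleftrightarrow> as \<noteq> [] \<and> distinct as \<and>
     (\<forall>i<length as. \<forall>j<length as. as ! i < as ! j \<longrightarrow> i < j)"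

end

theory Submission
  imports Defs
begin

text \<open>
  For monotone \<open>\<phi>\<close>, the value \<open>Lambda a \<phi> x\<close> is the length of a shortest path from \<open>a\<close> to \<open>x\<close>
  for the nonnegative edge lengths \<open>\<phi> (sup g h) - \<phi> g\<close>. Hence \<open>Lambda a \<phi>\<close> and \<open>\<phi> - Lambda a \<phi>\<close>
  are both monotone, the former vanishes at \<open>a\<close> and the latter takes its maximal value at \<open>a\<close>.
  Iterating along a linear extension \<open>b\<^sub>1, b\<^sub>2, \<dots>\<close> of the lattice splits \<open>\<phi>\<close> into monotone pieces, the
  \<open>i\<close>-th of which is a combination of indicators of up-sets containing \<open>b\<^sub>i\<close>.

  The required coupling exists iff the pair of \<open>\<phi>\<close> and the Moebius inverse \<open>f\<close> of \<open>\<psi>\<close> lies in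
  the convex hull of the pairs (indicator of \<open>U\<close>, unit vector of \<open>y\<close>) with \<open>U\<close> an up-set and
  \<open>y \<in> U\<close>. By separation this amounts to \<open>\<Sum>x. \<alpha> x * \<phi> x \<le> \<Sum>y. w y * f y\<close> for every \<open>\<alpha>\<close>, where
  \<open>w y\<close> is the largest \<open>\<alpha>\<close>-weight of an up-set containing \<open>y\<close>. As \<open>w\<close> is monotone, there is a linear
  extension along which \<open>w\<close> increases; for it, the decomposition of \<open>\<phi>\<close>, the hypothesis on
  monotone paths and summation by parts give the inequality.
\<close>

section \<open>Path costs and loop removal\<close>

text \<open>With these costs the maximum in \<open>lam\<close> becomes a minimum. Lists with
  repetitions are allowed, since appending a vertex to a path may repeat one.\<close>

fun path_cost :: "('a::{finite,bounded_lattice} \<Rightarrow> real) \<Rightarrow> 'a list \<Rightarrow> real" where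
  "path_cost \<phi> (g # h # hs) = \<phi> (sup g h) - \<phi> g + path_cost \<phi> (h # hs)"
| "path_cost \<phi> _ = 0"

lemma path_val_eq_last_minus_cost:
  "H \<noteq> [] \<Longrightarrow> path_val \<phi> H = \<phi> (last H) - path_cost \<phi> H"
  by (induction \<phi> H rule: path_cost.induct) (auto simp: path_val_def)

lemma path_cost_Cons:
  "hs \<noteq> [] \<Longrightarrow> path_cost \<phi> (g # hs) = \<phi> (sup g (hd hs)) - \<phi> g + path_cost \<phi> hs"
  by (cases hs) auto

lemma path_cost_snoc:
  "H \<noteq> [] \<Longrightarrow> path_cost \<phi> (H @ [x]) = path_cost \<phi> H + (\<phi> (sup (last H) x) - \<phi> (last H))"
  by (induction \<phi> H rule: path_cost.induct) auto

text \<open>Each edge length \<open>\<phi> (sup g h) - \<phi> g\<close> is at least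
  \<open>\<phi> h - \<phi> g\<close>, and these bounds telescope.\<close>

lemma path_cost_ge:
  assumes "mono \<phi>" "H \<noteq> []"
  shows "path_cost \<phi> H \<ge> \<phi> (last H) - \<phi> (hd H)"
  using assms(2)
proof (induction H)
  case (Cons g hs)
  then show ?case
    using monoD[OF assms(1), of "hd hs" "sup g (hd hs)"]
    by (cases "hs = []") (auto simp: path_cost_Cons)
qed simp

lemma path_cost_nonneg:
  assumes "mono \<phi>"
  shows "path_cost \<phi> H \<ge> 0"
proof (induction H)
  case (Cons g hs)
  then show ?case
    using monoD[OF assms, of g "sup g (hd hs)"]
    by (cases "hs = []") (auto simp: path_cost_Cons)
qed simp

lemma path_cost_append_ge:
  assumes "mono \<phi>"
  shows "path_cost \<phi> ys \<le> path_cost \<phi> (xs @ ys)"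
proof (induction xs)
  case (Cons g xs)
  then show ?case
    using monoD[OF assms, of g "sup g (hd (xs @ ys))"]
    by (cases "xs @ ys = []") (auto simp: path_cost_Cons)
qed simp

text \<open>Loop removal: if the new head already occurs in the distinct path found for the tail,
  everything before that occurrence is cut; the cut edges have nonnegative length.\<close>

lemma ex_distinct_path_cost_le:
  assumes "mono \<phi>" "H \<noteq> []"
  shows "\<exists>H'. is_path H' (hd H) (last H) \<and> path_cost \<phi> H' \<le> path_cost \<phi> H"
  using assms(2)
proof (induction H)
  case (Cons g hs)
  show ?case
  proof (cases "hs = []")
    case True
    then show ?thesis by (intro exI[of _ "[g]"]) (auto simp: is_path_def)
  next
    case False
    with Cons obtain H where H: "is_path H (hd hs) (last hs)" "path_cost \<phi> H \<le> path_cost \<phi> hs"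
      by blast
    show ?thesis
    proof (cases "g \<in> set H")
      case True
      then obtain xs ys where xy: "H = xs @ g # ys" by (meson split_list)
      have "path_cost \<phi> (g # ys) \<le> path_cost \<phi> H"
        unfolding xy by (rule path_cost_append_ge[OF assms(1)])
      also have "\<dots> \<le> path_cost \<phi> (g # hs)"
        using H(2) path_cost_append_ge[OF assms(1), of hs "[g]"] by simp
      finally show ?thesis
        using H(1) xy False by (intro exI[of _ "g # ys"]) (auto simp: is_path_def)
    next
      case g: False
      then show ?thesis
        using H False by (intro exI[of _ "g # H"]) (auto simp: is_path_def path_cost_Cons)
    qed
  qed
qed simp

section \<open>\<open>Lambda\<close> as a shortest-path distance\<close>

lemma finite_path_vals: "finite {path_val \<phi> H | H. is_path H a b}"
proof -
  have "length H \<le> card (UNIV :: 'a set)" if "distinct H" for H :: "'a list"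
    using distinct_card[OF that] card_mono[of UNIV "set H"] by simp
  then have "{H. is_path H a b} \<subseteq> {H :: 'a list. set H \<subseteq> UNIV \<and> length H \<le> card (UNIV :: 'a set)}"
    by (auto simp: is_path_def)
  then have "finite {H. is_path H a b}"
    by (rule finite_subset) (rule finite_lists_length_le, rule finite)
  then show ?thesis by (rule finite_image_set)
qed

lemma Lambda_attained:
  obtains H where "is_path H a x" "Lambda a \<phi> x = path_cost \<phi> H"
proof -
  have "is_path (if a = x then [a] else [a, x]) a x" by (auto simp: is_path_def)
  then have "{path_val \<phi> H | H. is_path H a x} \<noteq> {}" by blast
  from Max_in[OF finite_path_vals this] obtain H
    where H: "is_path H a x" "lam \<phi> a x = path_val \<phi> H"
    unfolding lam_def by auto
  then have "Lambda a \<phi> x = path_cost \<phi> H"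
    by (auto simp: Lambda_def path_val_eq_last_minus_cost is_path_def)
  with H that show thesis by blast
qed

lemma Lambda_le_path_cost:
  assumes "mono \<phi>" "H \<noteq> []"
  shows "Lambda (hd H) \<phi> (last H) \<le> path_cost \<phi> H"
proof -
  obtain H' where H': "is_path H' (hd H) (last H)" "path_cost \<phi> H' \<le> path_cost \<phi> H"
    using ex_distinct_path_cost_le[OF assms] by blast
  have "path_val \<phi> H' \<le> lam \<phi> (hd H) (last H)"
    unfolding lam_def using H'(1) by (intro Max_ge finite_path_vals) blast
  then show ?thesis
    using H' by (auto simp: Lambda_def path_val_eq_last_minus_cost is_path_def)
qed

text \<open>An optimal path to \<open>g\<close> is extended by \<open>h\<close>; loop removal makes
  a repetition of \<open>h\<close> harmless.\<close>

lemma Lambda_triangle: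
  assumes "mono \<phi>"
  shows "Lambda a \<phi> h \<le> Lambda a \<phi> g + (\<phi> (sup g h) - \<phi> g)"
proof -
  obtain H where H: "is_path H a g" "Lambda a \<phi> g = path_cost \<phi> H"
    by (rule Lambda_attained)
  then show ?thesis
    using Lambda_le_path_cost[OF assms, of "H @ [h]"]
    by (auto simp: is_path_def path_cost_snoc)
qed

text \<open>The edge from \<open>y\<close> down to any \<open>x \<le> y\<close> has length 0, so
  \<open>x\<close> is no farther from \<open>a\<close> than \<open>y\<close>.\<close>

lemma mono_Lambda: "mono \<phi> \<Longrightarrow> mono (Lambda a \<phi>)"
  using Lambda_triangle[of \<phi> a] by (intro monoI) (metis add.right_neutral diff_self sup_absorb1)

text \<open>The edge from \<open>x\<close> up to any \<open>y \<ge> x\<close> has length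
  \<open>\<phi> y - \<phi> x\<close>, so the distance grows by at most this amount.\<close>

lemma mono_minus_Lambda:
  assumes "mono \<phi>"
  shows "mono (\<lambda>x. \<phi> x - Lambda a \<phi> x)"
proof (rule monoI)
  fix x y :: 'a
  assume "x \<le> y"
  then show "\<phi> x - Lambda a \<phi> x \<le> \<phi> y - Lambda a \<phi> y"
    using Lambda_triangle[OF assms, of a y x] by (simp add: sup_absorb2)
qed

lemma Lambda_nonneg: "mono \<phi> \<Longrightarrow> Lambda a \<phi> x \<ge> 0"
  by (metis Lambda_attained path_cost_nonneg)

lemma Lambda_self: "mono \<phi> \<Longrightarrow> Lambda a \<phi> a = 0"
  using Lambda_le_path_cost[of \<phi> "[a]"] Lambda_nonneg[of \<phi> a a] by simp

lemma Lambda_bot: "mono \<phi> \<Longrightarrow> Lambda a \<phi> bot = 0"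
  using monoD[OF mono_Lambda, of \<phi> bot a a] Lambda_self[of \<phi> a] Lambda_nonneg[of \<phi> a bot]
  by simp

text \<open>The direct edge from \<open>a\<close> to \<open>top\<close> attains the telescoping
  lower bound for path costs.\<close>

lemma Lambda_top:
  assumes "mono \<phi>"
  shows "Lambda a \<phi> top = \<phi> top - \<phi> a"
proof (rule antisym)
  show "Lambda a \<phi> top \<le> \<phi> top - \<phi> a"
    using Lambda_le_path_cost[OF assms, of "[a, top]"] by simp
  obtain H where "is_path H a top" "Lambda a \<phi> top = path_cost \<phi> H"
    by (rule Lambda_attained)
  then show "\<phi> top - \<phi> a \<le> Lambda a \<phi> top"
    using path_cost_ge[OF assms, of H] by (auto simp: is_path_def)
qed

section \<open>Iterates of \<open>Lambda\<close>\<close>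

lemma Lambda_list_snoc: "Lambda_list (as @ [a]) \<phi> = Lambda a (Lambda_list as \<phi>)"
  by (simp add: Lambda_list_def)

lemma mono_Lambda_list: "mono \<phi> \<Longrightarrow> mono (Lambda_list as \<phi>)"
  by (induction as rule: rev_induct)
    (simp_all add: Lambda_list_snoc mono_Lambda, simp add: Lambda_list_def)

lemma Lambda_list_bot: "mono \<phi> \<Longrightarrow> \<phi> bot = 0 \<Longrightarrow> Lambda_list as \<phi> bot = 0"
  by (cases as rule: rev_cases)
    (simp_all add: Lambda_list_snoc Lambda_bot mono_Lambda_list, simp add: Lambda_list_def)

text \<open>A zero is created at \<open>a\<close> when \<open>a\<close> is processed and persists:
  the drop caused by a later step is monotone and vanishes at \<open>bot\<close>, so it is
  nonnegative and values only decrease towards 0.\<close>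

lemma Lambda_list_eq_0:
  assumes "mono \<phi>" "\<phi> bot = 0" "a \<in> set as"
  shows "Lambda_list as \<phi> a = 0"
  using assms(3)
proof (induction as rule: rev_induct)
  case (snoc b as)
  let ?\<phi> = "Lambda_list as \<phi>"
  note m = mono_Lambda_list[OF assms(1), of as]
  show ?case
  proof (cases "a = b")
    case True
    then show ?thesis by (simp add: Lambda_list_snoc Lambda_self[OF m])
  next
    case False
    then have "?\<phi> a = 0" using snoc by simp
    moreover have "?\<phi> bot - Lambda b ?\<phi> bot \<le> ?\<phi> a - Lambda b ?\<phi> a"
      using monoD[OF mono_minus_Lambda[OF m], of bot a] by simp
    ultimately show ?thesis
      using Lambda_nonneg[OF m, of b a] Lambda_bot[OF m, of b]
        Lambda_list_bot[OF assms(1,2), of as]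
      by (simp add: Lambda_list_snoc)
  qed
qed simp

section \<open>Inequalities for weighted sums\<close>

text \<open>Induction on the support of \<open>\<mu>\<close>, peeling off its lowest layer.\<close>

lemma sum_mono_le_of_upset_sums_le:
  fixes \<mu> \<alpha> :: "'a::{finite,bounded_lattice} \<Rightarrow> real"
  assumes "mono \<mu>" "\<And>x. \<mu> x \<ge> 0" "\<mu> b = \<mu> top"
    and W: "\<And>U. U \<in> upsets \<Longrightarrow> b \<in> U \<Longrightarrow> sum \<alpha> U \<le> W"
  shows "(\<Sum>x\<in>UNIV. \<alpha> x * \<mu> x) \<le> W * \<mu> top"
  using assms(1-3)
proof (induction "card {x. \<mu> x > 0}" arbitrary: \<mu> rule: less_induct)
  case less
  let ?U = "{x. \<mu> x > 0}"
  have le_top: "\<mu> x \<le> \<mu> top" for x using less.prems(1) by (simp add: monoD)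
  show ?case
  proof (cases "?U = {}")
    case True
    then have "\<not> \<mu> x > 0" for x by blast
    with less.prems(2) have "\<mu> x = 0" for x by (meson not_less order_antisym)
    then show ?thesis by simp
  next
    case False
    \<comment> \<open>As \<open>c\<close> is the least positive value of \<open>\<mu>\<close>,
      subtracting it on the support keeps \<open>\<mu>\<close> nonnegative and monotone and removes
      \<open>x0\<close> from the support.\<close>
    define c where "c = Min (\<mu> ` ?U)"
    have "c \<in> \<mu> ` ?U" unfolding c_def using False by (intro Min_in) auto
    then obtain x0 where x0: "\<mu> x0 = c" "c > 0" by auto
    have c_le: "c \<le> \<mu> x" if "\<mu> x > 0" for x
      unfolding c_def using that by (intro Min_le) auto
    have top: "\<mu> top > 0" using le_top[of x0] x0 by linarith
    define \<mu>' where "\<mu>' x = \<mu> x - c * indicator ?U x" for x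
    have \<mu>'_ge: "\<mu>' x \<ge> 0" for x
      using c_le[of x] less.prems(2)[of x] by (auto simp: \<mu>'_def indicator_def)
    have \<mu>'_mono: "mono \<mu>'"
    proof (rule monoI)
      fix x y :: 'a
      assume "x \<le> y"
      then have "\<mu> x \<le> \<mu> y" by (rule monoD[OF less.prems(1)])
      then show "\<mu>' x \<le> \<mu>' y"
        using c_le[of y] less.prems(2)[of x] by (auto simp: \<mu>'_def indicator_def)
    qed
    have "{x. \<mu>' x > 0} \<subset> ?U"
    proof
      show "{x. \<mu>' x > 0} \<subseteq> ?U"
        using less.prems(2) by (auto simp: \<mu>'_def indicator_def split: if_splits)
      have "x0 \<in> ?U" "x0 \<notin> {x. \<mu>' x > 0}"
        using x0 by (auto simp: \<mu>'_def indicator_def)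
      then show "{x. \<mu>' x > 0} \<noteq> ?U" by blast
    qed
    then have "card {x. \<mu>' x > 0} < card ?U" by (simp add: psubset_card_mono)
    moreover have "\<mu>' b = \<mu>' top" using less.prems(3) by (simp add: \<mu>'_def indicator_def)
    ultimately have IH: "(\<Sum>x\<in>UNIV. \<alpha> x * \<mu>' x) \<le> W * \<mu>' top"
      using less.hyps[OF _ \<mu>'_mono \<mu>'_ge] by blast
    \<comment> \<open>The support is an up-set by monotonicity and contains \<open>b\<close> because
      \<open>\<mu> b = \<mu> top > 0\<close>, so \<open>W\<close> bounds its weight.\<close>
    have "?U \<in> upsets"
      using False monoD[OF less.prems(1)] less_le_trans unfolding upsets_def by blast
    then have "sum \<alpha> ?U \<le> W" using W less.prems(3) top by simp
    then have "c * sum \<alpha> ?U \<le> c * W" using x0 by simp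
    moreover have "c * sum \<alpha> ?U = (\<Sum>x\<in>UNIV. \<alpha> x * (c * indicator ?U x))"
      unfolding sum_distrib_left
      by (rule sum.mono_neutral_cong_left) (auto simp: mult.commute)
    moreover have "(\<Sum>x\<in>UNIV. \<alpha> x * \<mu> x)
        = (\<Sum>x\<in>UNIV. \<alpha> x * \<mu>' x) + (\<Sum>x\<in>UNIV. \<alpha> x * (c * indicator ?U x))"
      unfolding sum.distrib[symmetric] by (rule sum.cong) (auto simp: \<mu>'_def algebra_simps)
    moreover have "W * \<mu>' top = W * \<mu> top - c * W"
      using top by (simp add: \<mu>'_def algebra_simps)
    ultimately show ?thesis using IH by linarith
  qed
qed

text \<open>Summation by parts: the difference of the two sides is the sum of the terms
  \<open>(w (Suc i) - w i) * (G (Suc i) - F (Suc i))\<close> with \<open>Suc i < n\<close>, the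
  boundary terms being 0.\<close>

lemma sum_weighted_differences_mono:
  fixes F G w :: "nat \<Rightarrow> real"
  assumes "F 0 = G 0" "F n = G n" "\<And>i. i \<le> n \<Longrightarrow> F i \<le> G i"
    and w: "\<And>i. Suc i < n \<Longrightarrow> w i \<le> w (Suc i)"
  shows "(\<Sum>i<n. w i * (F i - F (Suc i))) \<le> (\<Sum>i<n. w i * (G i - G (Suc i)))"
proof -
  define D where "D i = G i - F i" for i
  \<comment> \<open>A partial sum keeps a boundary term at its upper end, which vanishes for
    \<open>Suc k = n\<close>.\<close>
  have "(\<Sum>i<Suc k. w i * (D i - D (Suc i))) \<ge> - w k * D (Suc k)" if "Suc k \<le> n" for k
    using that
  proof (induction k)
    case 0
    then show ?case using assms(1) by (simp add: D_def algebra_simps)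
  next
    case (Suc k)
    then have "w k * D (Suc k) \<le> w (Suc k) * D (Suc k)"
      using w[of k] assms(3)[of "Suc k"] by (intro mult_right_mono) (auto simp: D_def)
    then show ?case using Suc by (simp add: algebra_simps)
  qed
  from this[of "n - 1"] have "(\<Sum>i<n. w i * (D i - D (Suc i))) \<ge> 0"
    using assms(2) by (cases n) (auto simp: D_def)
  also have "(\<Sum>i<n. w i * (D i - D (Suc i)))
      = (\<Sum>i<n. w i * (G i - G (Suc i))) - (\<Sum>i<n. w i * (F i - F (Suc i)))"
    unfolding sum_subtractf[symmetric] by (rule sum.cong) (auto simp: D_def algebra_simps)
  finally show ?thesis by simp
qed

section \<open>Linear extensions and Moebius inversion\<close>

text \<open>The last element is a maximal one among the maximizers of \<open>w\<close> on
  \<open>A\<close>. Anything in \<open>A\<close> above it would be a maximizer too, as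
  \<open>w\<close> is monotone.\<close>

lemma ex_linear_extension_sorted_by:
  fixes w :: "'a::{finite,order} \<Rightarrow> real"
  assumes "mono w"
  shows "\<exists>bs. distinct bs \<and> set bs = A \<and> sorted_wrt (\<lambda>x y. w x \<le> w y \<and> \<not> y < x) bs"
proof (induction "card A" arbitrary: A)
  case 0
  then show ?case by (intro exI[of _ "[]"]) auto
next
  case (Suc n)
  then have ne: "A \<noteq> {}" by auto
  let ?M = "{x \<in> A. w x = Max (w ` A)}"
  have "Max (w ` A) \<in> w ` A" using ne by (intro Max_in) auto
  then have "?M \<noteq> {}" by auto
  then obtain b where b: "b \<in> ?M" "\<And>x. x \<in> ?M \<Longrightarrow> b \<le> x \<Longrightarrow> b = x"
    using finite_has_maximal[of ?M] by auto
  have w_le: "w x \<le> w b" if "x \<in> A" for x using b(1) that by simp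
  have max: "\<not> b < x" if "x \<in> A" for x
  proof
    assume "b < x"
    then have "w x = w b" using w_le[OF that] monoD[OF assms, of b x] by simp
    then have "x \<in> ?M" using b(1) that by simp
    then show False using b(2) \<open>b < x\<close> by (metis less_le)
  qed
  have "n = card (A - {b})" using Suc.hyps(2) b(1) by simp
  then obtain bs where "distinct bs" "set bs = A - {b}"
    "sorted_wrt (\<lambda>x y. w x \<le> w y \<and> \<not> y < x) bs"
    using Suc.hyps(1) by blast
  then show ?case
    using b(1) w_le max by (intro exI[of _ "bs @ [b]"]) (auto simp: sorted_wrt_append)
qed

text \<open>Since \<open>y \<le> inf x a\<close> means \<open>y \<le> x\<close> and
  \<open>y \<le> a\<close>, each \<open>nabla a\<close> deletes the elements below \<open>a\<close>
  from the sum.\<close>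

lemma nabla_list_eq_sum:
  fixes f :: "'a::{finite,bounded_lattice} \<Rightarrow> real"
  assumes "\<And>x. \<psi> x = (\<Sum>y | y \<le> x. f y)"
  shows "nabla_list as \<psi> x = (\<Sum>y | y \<le> x \<and> (\<forall>a\<in>set as. \<not> y \<le> a). f y)"
proof (induction as arbitrary: x rule: rev_induct)
  case Nil
  then show ?case by (simp add: nabla_list_def assms)
next
  case (snoc a as)
  let ?S = "\<lambda>x. {y. y \<le> x \<and> (\<forall>a\<in>set as. \<not> y \<le> a)}"
  have "nabla_list (as @ [a]) \<psi> x = sum f (?S x) - sum f (?S (inf x a))"
    using snoc by (simp add: nabla_list_def nabla_def)
  also have "\<dots> = sum f (?S x - ?S (inf x a))"
    by (intro sum_diff[symmetric]) auto
  also have "?S x - ?S (inf x a) = {y. y \<le> x \<and> (\<forall>a\<in>set (as @ [a]). \<not> y \<le> a)}"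
    by auto
  finally show ?case .
qed

text \<open>Moebius inversion without the Moebius function: along a linear extension, the equation
  at \<open>b\<close> determines \<open>f b\<close>, and this choice leaves the earlier equations
  intact.\<close>

lemma ex_sum_below_eq:
  fixes \<psi> :: "'a::{finite,order} \<Rightarrow> real"
  shows "\<exists>f. \<forall>x. \<psi> x = (\<Sum>y | y \<le> x. f y)"
proof -
  obtain bs :: "'a list" where bs: "distinct bs" "set bs = UNIV"
    "sorted_wrt (\<lambda>x y. \<not> y < x) bs"
    using ex_linear_extension_sorted_by[of "\<lambda>_. 0" UNIV] by (auto simp: mono_def)
  have "\<exists>f. \<forall>x\<in>set xs. \<psi> x = (\<Sum>y | y \<le> x. f y)"
    if "xs @ ys = bs" for xs ys
    using that
  proof (induction xs arbitrary: ys rule: rev_induct)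
    case (snoc b xs)
    then obtain f where f: "\<forall>x\<in>set xs. \<psi> x = (\<Sum>y | y \<le> x. f y)"
      by (metis append.assoc)
    let ?f = "f(b := \<psi> b - (\<Sum>y | y < b. f y))"
    have nle: "\<not> b \<le> x" if "x \<in> set xs" for x
      using that bs(1,3) snoc.prems[symmetric] by (auto simp: sorted_wrt_append le_less)
    have "\<psi> x = (\<Sum>y | y \<le> x. ?f y)" if "x \<in> set xs" for x
    proof -
      have "(\<Sum>y | y \<le> x. ?f y) = (\<Sum>y | y \<le> x. f y)"
        using nle[OF that] by (intro sum.cong) auto
      then show ?thesis using f that by simp
    qed
    moreover have "\<psi> b = (\<Sum>y | y \<le> b. ?f y)"
    proof -
      have "{y. y \<le> b} = insert b {y. y < b}" by auto
      then have "(\<Sum>y | y \<le> b. ?f y) = ?f b + (\<Sum>y | y < b. ?f y)"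
        by (simp del: fun_upd_apply)
      also have "(\<Sum>y | y < b. ?f y) = (\<Sum>y | y < b. f y)" by (rule sum.cong) auto
      finally show ?thesis by simp
    qed
    ultimately show ?case by (intro exI[of _ ?f]) auto
  qed simp
  from this[of bs "[]"] bs(2) show ?thesis by auto
qed

text \<open>Applying \<open>nabla\<close> for all elements strictly below \<open>x\<close> isolates
  \<open>f x\<close> in the sum for \<open>\<psi> x\<close>.\<close>

lemma completely_monotone_density:
  fixes \<psi> :: "'a::{finite,bounded_lattice} \<Rightarrow> real"
  assumes "completely_monotone \<psi>" "\<psi> bot = 0"
  obtains f where "\<And>x. f x \<ge> 0" "\<And>x. \<psi> x = (\<Sum>y | y \<le> x. f y)"
proof -
  from ex_sum_below_eq[of \<psi>] obtain f where "\<forall>x. \<psi> x = (\<Sum>y | y \<le> x. f y)" ..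
  then have f: "\<psi> x = (\<Sum>y | y \<le> x. f y)" for x ..
  have "f x \<ge> 0" for x
  \<comment> \<open>Nothing lies strictly below \<open>bot\<close>, and complete monotonicity speaks
    only of nonempty lists.\<close>
  proof (cases "x = bot")
    case True
    moreover have "{y :: 'a. y \<le> bot} = {bot}" by (auto simp: bot_unique)
    ultimately have "\<psi> x = f x" using f[of x] by simp
    then show ?thesis using True assms(2) by simp
  next
    case False
    obtain as where as: "set as = {y. y < x}" using finite_list[of "{y. y < x}"] by auto
    have "bot < x" using False bot.not_eq_extremum by blast
    then have "bot \<in> set as" unfolding as by (rule CollectI)
    then have "as \<noteq> []" by force
    then have "nabla_list as \<psi> x \<ge> 0" using assms(1) by (auto simp: completely_monotone_def)
    moreover have "{y. y \<le> x \<and> (\<forall>a\<in>set as. \<not> y \<le> a)} = {x}"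
      unfolding as by (auto simp: less_le_not_le intro: antisym)
    ultimately show ?thesis by (simp add: nabla_list_eq_sum[OF f])
  qed
  then show thesis using f by (rule that)
qed

section \<open>The dual inequality\<close>

lemma sum_le_sum_max_upset_weight:
  fixes \<phi> \<psi> f \<alpha> w :: "'a::{finite,bounded_lattice} \<Rightarrow> real"
  assumes "capacity \<phi>" "capacity \<psi>" and f: "\<And>x. \<psi> x = (\<Sum>y | y \<le> x. f y)"
    and hyp: "\<And>as. monotone_path as \<Longrightarrow> Lambda_list as \<phi> top \<le> nabla_list as \<psi> top"
    and "mono w" and w: "\<And>U y. U \<in> upsets \<Longrightarrow> y \<in> U \<Longrightarrow> sum \<alpha> U \<le> w y"
  shows "(\<Sum>x\<in>UNIV. \<alpha> x * \<phi> x) \<le> (\<Sum>y\<in>UNIV. w y * f y)"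
proof -
  have \<phi>: "mono \<phi>" "\<phi> bot = 0" "\<phi> top = 1" and \<psi>: "\<psi> top = 1"
    using assms(1,2) by (auto simp: capacity_def)
  obtain bs :: "'a list" where bs: "distinct bs" "set bs = UNIV"
    "sorted_wrt (\<lambda>x y. w x \<le> w y \<and> \<not> y < x) bs"
    using ex_linear_extension_sorted_by[OF \<open>mono w\<close>, of UNIV] by auto
  let ?n = "length bs"
  \<comment> \<open>\<open>F i\<close> is what remains of \<open>\<phi>\<close> after
    \<open>i\<close> steps; \<open>G i\<close> is the mass of \<open>f\<close> on the elements from
    position \<open>i\<close> on.\<close>
  define F where "F i = Lambda_list (take i bs) \<phi>" for i
  define G where "G i = nabla_list (take i bs) \<psi> top" for i
  have mF: "mono (F i)" for i unfolding F_def by (rule mono_Lambda_list[OF \<phi>(1)])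
  have F_bot: "F i bot = 0" for i unfolding F_def by (rule Lambda_list_bot[OF \<phi>(1,2)])
  have F_Suc: "F (Suc i) = Lambda (bs ! i) (F i)" if "i < ?n" for i
    using that by (simp add: F_def take_Suc_conv_app_nth Lambda_list_snoc)
  have nless: "\<not> bs ! j < bs ! i" if "i < j" "j < ?n" for i j
    using bs(3) that by (auto simp: sorted_wrt_iff_nth_less)
  have path: "monotone_path (take i bs)" if "0 < i" "i \<le> ?n" for i
    unfolding monotone_path_def
  proof (intro conjI allI impI)
    show "take i bs \<noteq> []" "distinct (take i bs)" using that bs(1) by auto
    fix j k
    assume "j < length (take i bs)" "k < length (take i bs)" "take i bs ! j < take i bs ! k"
    then show "j < k"
      using nless[of k j] by (cases j k rule: linorder_cases) auto
  qed
  have F_n: "F ?n x = 0" for x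
    unfolding F_def using bs(2) by (simp add: Lambda_list_eq_0[OF \<phi>(1,2)])
  \<comment> \<open>Elements strictly below \<open>bs ! i\<close> come earlier in \<open>bs\<close>,
    so passing from \<open>i\<close> to \<open>Suc i\<close> discards \<open>bs ! i\<close>
    alone.\<close>
  have G_diff: "G i - G (Suc i) = f (bs ! i)" if "i < ?n" for i
  proof -
    let ?S = "\<lambda>i. {y. \<forall>a\<in>set (take i bs). \<not> y \<le> a}"
    have "\<not> bs ! i \<le> a" if a: "a \<in> set (take i bs)" for a
    proof -
      obtain j where "j < i" "a = bs ! j" using a by (auto simp: in_set_conv_nth)
      then show ?thesis
        using nless[of j i] \<open>i < ?n\<close> bs(1) by (auto simp: le_less nth_eq_iff_index_eq)
    qed
    moreover have "y = bs ! i" if y: "y \<in> ?S i" "y \<le> bs ! i" for y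
    proof -
      obtain j where j: "j < ?n" "y = bs ! j" using bs(2) by (metis UNIV_I in_set_conv_nth)
      have "\<not> j < i"
      proof
        assume "j < i"
        then have "y \<in> set (take i bs)" using j by (auto simp: in_set_conv_nth)
        then show False using y(1) by auto
      qed
      then show ?thesis
        using nless[of i j] j y(2) by (cases "i = j") (auto simp: le_less)
    qed
    ultimately have "?S i - ?S (Suc i) = {bs ! i}"
      using that by (auto simp: take_Suc_conv_app_nth)
    moreover have "?S (Suc i) \<subseteq> ?S i" using that by (auto simp: take_Suc_conv_app_nth)
    ultimately show ?thesis
      using sum_diff[of "?S i" "?S (Suc i)" f]
      by (simp add: G_def nabla_list_eq_sum[OF f])
  qed
  have G_n: "G ?n = 0"
    unfolding G_def nabla_list_eq_sum[OF f] using bs(2) by (auto intro!: sum.neutral)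
  have piece: "(\<Sum>x\<in>UNIV. \<alpha> x * (F i x - F (Suc i) x)) \<le> w (bs ! i) * (F i top - F (Suc i) top)"
    if "i < ?n" for i
  proof (rule sum_mono_le_of_upset_sums_le[where b = "bs ! i"])
    show m: "mono (\<lambda>x. F i x - F (Suc i) x)"
      unfolding F_Suc[OF that] by (rule mono_minus_Lambda[OF mF])
    show "F i x - F (Suc i) x \<ge> 0" for x
      using monoD[OF m, of bot x] F_bot by simp
    \<comment> \<open>Both sides equal \<open>F i (bs ! i)\<close>.\<close>
    show "F i (bs ! i) - F (Suc i) (bs ! i) = F i top - F (Suc i) top"
      by (simp add: F_Suc[OF that] Lambda_self[OF mF] Lambda_top[OF mF])
  qed (rule w)
  have "(\<Sum>x\<in>UNIV. \<alpha> x * \<phi> x) = (\<Sum>x\<in>UNIV. \<alpha> x * (\<Sum>i<?n. F i x - F (Suc i) x))"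
    by (subst sum_lessThan_telescope') (simp add: F_n, simp add: F_def Lambda_list_def)
  also have "\<dots> = (\<Sum>i<?n. \<Sum>x\<in>UNIV. \<alpha> x * (F i x - F (Suc i) x))"
    by (simp add: sum_distrib_left) (rule sum.swap)
  also have "\<dots> \<le> (\<Sum>i<?n. w (bs ! i) * (F i top - F (Suc i) top))"
    by (intro sum_mono) (simp add: piece)
  also have "\<dots> \<le> (\<Sum>i<?n. w (bs ! i) * (G i - G (Suc i)))"
  proof (rule sum_weighted_differences_mono)
    show F0: "F 0 top = G 0"
      using \<phi>(3) \<psi> by (simp add: F_def G_def Lambda_list_def nabla_list_def)
    show "F ?n top = G ?n" by (simp add: F_n G_n)
    \<comment> \<open>The empty list is not a monotone path; for \<open>i = 0\<close> the
      normalization \<open>\<phi> top = \<psi> top\<close> is used instead.\<close>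
    show "F i top \<le> G i" if "i \<le> ?n" for i
      using F0 hyp[OF path[of i]] that by (cases "i = 0") (auto simp: F_def G_def)
    show "w (bs ! i) \<le> w (bs ! Suc i)" if "Suc i < ?n" for i
      using bs(3) that by (auto simp: sorted_wrt_iff_nth_less)
  qed
  also have "\<dots> = (\<Sum>i<?n. w (bs ! i) * f (bs ! i))" by (simp add: G_diff)
  also have "\<dots> = (\<Sum>y\<in>UNIV. w y * f y)"
    using sum.distinct_set_conv_list[OF bs(1), of "\<lambda>y. w y * f y"] bs(2)
    by (simp add: sum_list_sum_nth atLeast0LessThan)
  finally show ?thesis .
qed

section \<open>Convex combinations and the coupling\<close>

text \<open>The weights of a convex combination are attached to points; injectivity of
  \<open>v\<close> moves them to indices without double counting.\<close>

lemma ex_pmf_of_mem_convex_hull_image: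
  fixes v :: "'i::finite \<Rightarrow> 'b::real_vector"
  assumes "x \<in> convex hull (v ` S)" "inj_on v S"
  obtains p where "set_pmf p \<subseteq> S" "x = (\<Sum>i\<in>UNIV. pmf p i *\<^sub>R v i)"
proof -
  obtain u where u: "\<forall>y\<in>v ` S. 0 \<le> u y" "sum u (v ` S) = 1" "(\<Sum>y\<in>v ` S. u y *\<^sub>R y) = x"
    using assms(1) by (auto simp: convex_hull_finite)
  define c where "c i = (if i \<in> S then u (v i) else 0)" for i
  have c: "c i \<ge> 0" for i using u(1) by (auto simp: c_def)
  have "sum c UNIV = sum (u \<circ> v) S"
    by (auto simp: c_def sum.If_cases)
  then have c_sum: "sum c UNIV = 1"
    using u(2) by (simp add: sum.reindex[OF assms(2)])
  have "(\<integral>\<^sup>+ i. ennreal (c i) \<partial>count_space UNIV) = 1"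
    by (simp add: nn_integral_count_space_finite sum_ennreal c c_sum)
  then have pmf: "pmf (embed_pmf c) i = c i" for i
    using c by (intro pmf_embed_pmf)
  have "(\<Sum>i\<in>UNIV. c i *\<^sub>R v i) = (\<Sum>i\<in>S. u (v i) *\<^sub>R v i)"
    by (intro sum.mono_neutral_cong_right) (auto simp: c_def)
  then have "x = (\<Sum>i\<in>UNIV. c i *\<^sub>R v i)"
    using u(3) by (simp add: sum.reindex[OF assms(2)])
  moreover have "set_pmf (embed_pmf c) \<subseteq> S"
    by (auto simp: set_pmf_iff pmf c_def split: if_splits)
  ultimately show thesis using that[of "embed_pmf c"] by (simp add: pmf)
qed

theorem theorem4p3:
  fixes \<phi> \<psi> :: "'a::{finite,bounded_lattice} \<Rightarrow> real"
  assumes "capacity \<phi>" and "capacity \<psi>" and "completely_monotone \<psi>"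
    and "\<And>as. monotone_path as \<Longrightarrow> Lambda_list as \<phi> top \<le> nabla_list as \<psi> top"
  shows "\<exists>p :: ('a set \<times> 'a) pmf.
           (\<forall>z\<in>set_pmf p. fst z \<in> upsets) \<and>
           (\<forall>x. measure_pmf.prob p {z. x \<in> fst z} = \<phi> x) \<and>
           (\<forall>x. measure_pmf.prob p {z. snd z \<le> x} = \<psi> x) \<and>
           measure_pmf.prob p {z. snd z \<in> fst z} = 1"
proof -
  obtain f where f: "\<And>x. f x \<ge> 0" "\<And>x. \<psi> x = (\<Sum>y | y \<le> x. f y)"
    using completely_monotone_density[OF assms(3)] assms(2) by (auto simp: capacity_def)
  have f_sum: "sum f UNIV = 1" using f(2)[of top] assms(2) by (simp add: capacity_def)
  define S :: "('a set \<times> 'a) set" where "S = {(U, y). U \<in> upsets \<and> y \<in> U}"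
  define v :: "'a set \<times> 'a \<Rightarrow> (real, 'a) vec \<times> (real, 'a) vec"
    where "v z = (\<chi> x. indicator (fst z) x, \<chi> x. indicator {snd z} x)" for z
  define t :: "(real, 'a) vec \<times> (real, 'a) vec" where "t = (\<chi> x. \<phi> x, \<chi> x. f x)"
  have "inj v"
    by (rule injI)
      (auto simp: v_def vec_eq_iff indicator_def prod_eq_iff of_bool_eq_iff)
  have "t \<in> convex hull (v ` S)"
  proof (rule ccontr)
    assume "t \<notin> convex hull (v ` S)"
    moreover have "closed (convex hull (v ` S))"
      by (simp add: compact_convex_hull compact_imp_closed finite_imp_compact)
    ultimately obtain d b where d: "d \<bullet> t < b" "\<And>x. x \<in> convex hull (v ` S) \<Longrightarrow> b < d \<bullet> x"
      using separating_hyperplane_closed_point[of "convex hull (v ` S)" t] convex_convex_hull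
      by blast
    \<comment> \<open>The sign is chosen so that separation from the vertices bounds up-set weights
      from above.\<close>
    define \<alpha> where "\<alpha> x = - (fst d $ x)" for x
    define \<beta> where "\<beta> x = snd d $ x" for x
    have le: "sum \<alpha> U \<le> \<beta> y - b" if "U \<in> upsets" "y \<in> U" for U y
    proof -
      have "b < d \<bullet> v (U, y)" using that by (intro d(2) hull_inc) (auto simp: S_def)
      also have "d \<bullet> v (U, y) = - sum \<alpha> U + \<beta> y"
        by (simp add: v_def inner_prod_def inner_vec_def \<alpha>_def \<beta>_def sum_negf
            sum_mult_indicator del: indicator_simps)
      finally show ?thesis by simp
    qed
    \<comment> \<open>The bound \<open>\<beta> y - b\<close> need not be monotone in
      \<open>y\<close>. The least such bound \<open>w\<close> is, because an up-set containing
      \<open>y\<close> contains everything above \<open>y\<close>.\<close>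
    define w where "w y = Max {sum \<alpha> U | U. U \<in> upsets \<and> y \<in> U}" for y
    have fin: "finite {sum \<alpha> U | U. U \<in> upsets \<and> y \<in> U}" for y
      by (rule finite_image_set) (rule finite)
    have "UNIV \<in> (upsets :: 'a set set)" by (simp add: upsets_def)
    then have ne: "{sum \<alpha> U | U. U \<in> upsets \<and> y \<in> U} \<noteq> {}" for y by blast
    have "mono w"
      unfolding w_def
      by (intro monoI Max_mono fin ne) (auto simp: upsets_def)
    moreover have "sum \<alpha> U \<le> w y" if "U \<in> upsets" "y \<in> U" for U y
      unfolding w_def using that by (intro Max_ge fin) blast
    ultimately have "(\<Sum>x\<in>UNIV. \<alpha> x * \<phi> x) \<le> (\<Sum>y\<in>UNIV. w y * f y)"
      by (intro sum_le_sum_max_upset_weight[OF assms(1,2) f(2) assms(4)])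
    also have "\<dots> \<le> (\<Sum>y\<in>UNIV. (\<beta> y - b) * f y)"
    proof (intro sum_mono mult_right_mono f(1))
      show "w y \<le> \<beta> y - b" for y
        unfolding w_def using le by (subst Max_le_iff[OF fin ne]) auto
    qed
    also have "\<dots> = (\<Sum>y\<in>UNIV. \<beta> y * f y) - b"
      using f_sum by (simp add: left_diff_distrib sum_subtractf sum_distrib_left[symmetric])
    \<comment> \<open>The inequality just obtained says
      \<open>b \<le> d \<bullet> t\<close>.\<close>
    finally show False
      using d(1) by (simp add: t_def inner_prod_def inner_vec_def \<alpha>_def \<beta>_def sum_negf)
  qed
  then obtain p where p: "set_pmf p \<subseteq> S" "t = (\<Sum>z\<in>UNIV. pmf p z *\<^sub>R v z)"
    using ex_pmf_of_mem_convex_hull_image inj_on_subset[OF \<open>inj v\<close> subset_UNIV] by blast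
  have prob: "measure_pmf.prob p {z. P z} = (\<Sum>z\<in>UNIV. pmf p z * indicator {z. P z} z)" for P
    by (simp add: measure_measure_pmf_finite sum_mult_indicator)
  have "measure_pmf.prob p {z. x \<in> fst z} = \<phi> x" for x
  proof -
    have "\<phi> x = fst t $ x" by (simp add: t_def)
    also have "\<dots> = (\<Sum>z\<in>UNIV. pmf p z * indicator (fst z) x)"
      by (simp add: p(2) fst_sum v_def)
    finally show ?thesis by (simp add: prob indicator_def)
  qed
  moreover have "measure_pmf.prob p {z. snd z \<le> x} = \<psi> x" for x
  proof -
    \<comment> \<open>The second component of \<open>t\<close> gives the point masses of
      \<open>snd z\<close>; summing them over \<open>y \<le> x\<close> yields
      \<open>\<psi> x\<close>.\<close>
    have "f y = (\<Sum>z\<in>UNIV. pmf p z * indicator {snd z} y)" for y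
    proof -
      have "f y = snd t $ y" by (simp add: t_def)
      then show ?thesis by (simp add: p(2) snd_sum v_def)
    qed
    then have "\<psi> x = (\<Sum>y | y \<le> x. \<Sum>z\<in>UNIV. pmf p z * indicator {snd z} y)"
      by (simp add: f(2))
    also have "\<dots> = (\<Sum>z\<in>UNIV. \<Sum>y | y \<le> x. pmf p z * indicator {snd z} y)"
      by (rule sum.swap)
    also have "\<dots> = (\<Sum>z\<in>UNIV. pmf p z * indicator {z. snd z \<le> x} z)"
      by (intro sum.cong refl) (auto simp: sum_distrib_left[symmetric] indicator_def)
    finally show ?thesis by (simp add: prob)
  qed
  moreover have "measure_pmf.prob p {z. snd z \<in> fst z} = 1"
    using p(1) by (subst measure_pmf.prob_eq_1) (auto simp: AE_measure_pmf_iff S_def)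
  moreover have "\<forall>z\<in>set_pmf p. fst z \<in> upsets" using p(1) by (auto simp: S_def)
  ultimately show ?thesis by blast
qed

end
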